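(* Let $0<\nu<1$, let $\mathbf{F}_0\in\mathbb{R}^n$, let $k$ satisfy $|\rho_{k,1}|=\max_{1\le i\le p}|\rho_{i,1}|\neq 0$, and let $j\ne k$. Suppose the first two critical directions are $(k,j)$: the first $m\ge 1$ steps are taken along $k$ and the next step, $m+1$, is taken along $j$. Suppose that the step size taken along $k$, $\nu_{j,k}=1-(1-\nu)^m$, satisfies $\nu_{j,k}=\hat\nu_j$, where $$\hat\nu_j=1-\frac{|d_{j,k}-R_{j,k}|}{1-R_{j,k}\,\mathrm{sgn}(d_{j,k}-R_{j,k})}.$$ If $d^{(m)}_{j,k}\ne R_{j,k}$, then $k$ is favored over $j$ for the next step after $j$; that is, $|\rho_{j,m+1}|\ge|\rho_{k,m+1}|$ and $|\rho_{j,m+2}|<|\rho_{k,m+2}|$.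
   Context: $\mathbf{y}=(y_1,\dots,y_n)^T\in\mathbb{R}^n$ is a response vector and $\mathbf{X}=[\mathbf{X}_1,\dots,\mathbf{X}_p]$ is an $n\times p$ real design matrix with columns $\mathbf{X}_k=(x_{1,k},\dots,x_{n,k})^T$. The data are standardized: $\sum_i y_i=0$, $\sum_i x_{i,k}=0$ and $\sum_i x_{i,k}^2=1$ for each $k$. A step $t\ge 1$ taken along direction $i$ means $\mathbf{F}_t=\mathbf{F}_{t-1}+\nu\,\rho_{i,t}\mathbf{X}_i$, where for every coordinate $l$ the gradient-correlation at step $t$ is $\rho_{l,t}=\mathbf{X}_l^T(\mathbf{y}-\mathbf{F}_{t-1})$. Notation: $R_{j,k}=\mathbf{X}_j^T\mathbf{X}_k$, $d_{j,k}=\rho_{j,1}/\rho_{k,1}$, $d^{(m)}_{j,k}=\rho_{j,m}/\rho_{k,m}$, $\mathrm{sgn}(0)=0$. A direction $a$ is more favorable than the current direction $b$ at step $t+1$ if $|\rho_{b,t}|\ge|\rho_{a,t}|$ and $|\rho_{b,t+1}|<|\rho_{a,t+1}|$. *)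

theory Defs
  imports "HOL-Analysis.Analysis"
begin

(* The n x p design matrix is X :: real^'p^'n; its k-th column is "column k X". *)

definition standardized :: "real^'p^'n \<Rightarrow> real^'n \<Rightarrow> bool" where
  "standardized X y \<longleftrightarrow>
     (\<Sum>i\<in>UNIV. y $ i) = 0 \<and>
     (\<forall>k. (\<Sum>i\<in>UNIV. X $ i $ k) = 0 \<and> (\<Sum>i\<in>UNIV. (X $ i $ k)\<^sup>2) = 1)"

(* The gradient-correlation at step t is taken against the residual of the previous iterate.
   Steps are numbered from 1, so the truncated subtraction is only meaningful for t >= 1. *)
definition grad_corr ::
  "real^'p^'n \<Rightarrow> real^'n \<Rightarrow> (nat \<Rightarrow> real^'n) \<Rightarrow> 'p \<Rightarrow> nat \<Rightarrow> real" where
  "grad_corr X y F l t = column l X \<bullet> (y - F (t - 1))"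

definition step_along ::
  "real^'p^'n \<Rightarrow> real^'n \<Rightarrow> real \<Rightarrow> (nat \<Rightarrow> real^'n) \<Rightarrow> 'p \<Rightarrow> nat \<Rightarrow> bool" where
  "step_along X y \<nu> F i t \<longleftrightarrow>
     t \<ge> 1 \<and> F t = F (t - 1) + (\<nu> * grad_corr X y F i t) *\<^sub>R column i X"

definition col_corr :: "real^'p^'n \<Rightarrow> 'p \<Rightarrow> 'p \<Rightarrow> real" where
  "col_corr X j k = column j X \<bullet> column k X"

definition grad_ratio ::
  "real^'p^'n \<Rightarrow> real^'n \<Rightarrow> (nat \<Rightarrow> real^'n) \<Rightarrow> nat \<Rightarrow> 'p \<Rightarrow> 'p \<Rightarrow> real" where
  "grad_ratio X y F m j k = grad_corr X y F j m / grad_corr X y F k m"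

(* If the denominator vanishes, HOL division makes the value 1, which is never of the form
   1 - (1 - \<nu>)^m with 0 < \<nu> < 1; equating the two thus excludes the degenerate case. *)
definition nu_hat ::
  "real^'p^'n \<Rightarrow> real^'n \<Rightarrow> (nat \<Rightarrow> real^'n) \<Rightarrow> 'p \<Rightarrow> 'p \<Rightarrow> real" where
  "nu_hat X y F j k =
     (let d = grad_ratio X y F 1 j k; R = col_corr X j k
      in 1 - \<bar>d - R\<bar> / (1 - R * sgn (d - R)))"

(* Direction a is more favorable than the current direction b at step t + 1. *)
definition more_favorable_next ::
  "real^'p^'n \<Rightarrow> real^'n \<Rightarrow> (nat \<Rightarrow> real^'n) \<Rightarrow> nat \<Rightarrow> 'p \<Rightarrow> 'p \<Rightarrow> bool" where
  "more_favorable_next X y F t a b \<longleftrightarrow>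
     \<bar>grad_corr X y F b t\<bar> \<ge> \<bar>grad_corr X y F a t\<bar> \<and>
     \<bar>grad_corr X y F b (t + 1)\<bar> < \<bar>grad_corr X y F a (t + 1)\<bar>"

end

theory Submission
  imports Defs
begin

text \<open>
  Put $q = (1-\nu)^m$, $r = \rho_{k,1}$ and $s = \mathrm{sgn}(d_{j,k} - R_{j,k})$. After $m$ steps
  along $k$ we have $\rho_{k,m+1} = q r$ and $\rho_{j,m+1} = (d_{j,k} - R_{j,k} + R_{j,k}\, q)\, r$.
  The condition $1 - q = \hat\nu_j$ says $d_{j,k} - R_{j,k} = q (s - R_{j,k})$, so
  $\rho_{j,m+1} = s q r$: the two correlations tie in absolute value. The step along $j$ then shrinks
  $|\rho_j|$ by $1 - \nu$, but $|\rho_k|$ only by $1 - \nu R_{j,k} s$, and $R_{j,k} s < 1$.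
\<close>

lemma col_corr_self:
  assumes "standardized X y"
  shows "col_corr X k k = 1"
  using assms
  by (simp add: standardized_def col_corr_def inner_vec_def column_def power2_eq_square)

lemma abs_col_corr_le_1:
  assumes "standardized X y"
  shows "\<bar>col_corr X j k\<bar> \<le> 1"
proof -
  have "norm (column i X) = 1" for i
    using col_corr_self[OF assms, of i] by (simp add: col_corr_def norm_eq_sqrt_inner)
  then show ?thesis
    using Cauchy_Schwarz_ineq2[of "column j X" "column k X"] by (simp add: col_corr_def)
qed

lemma grad_corr_step:
  assumes "step_along X y \<nu> F i t"
  shows "grad_corr X y F l (t + 1) =
    grad_corr X y F l t - \<nu> * grad_corr X y F i t * col_corr X l i"
proof -
  have "F t = F (t - 1) + (\<nu> * grad_corr X y F i t) *\<^sub>R column i X"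
    using assms by (simp add: step_along_def)
  then have "column l X \<bullet> (y - F t) =
    column l X \<bullet> (y - F (t - 1)) - \<nu> * grad_corr X y F i t * (column l X \<bullet> column i X)"
    by (simp add: inner_diff_right inner_add_right)
  then show ?thesis
    by (simp add: grad_corr_def col_corr_def)
qed

text \<open>Each step along \<open>k\<close> multiplies the correlation of \<open>k\<close> by
  \<open>1 - \<nu>\<close>, because the columns have unit norm. The decrements of the correlation of
  \<open>l\<close> therefore form a geometric series, whose sum carries the factor
  \<open>1 - (1 - \<nu>) ^ m\<close>.\<close>

lemma grad_corr_steps:
  assumes "standardized X y" and "\<forall>t\<in>{1..m}. step_along X y \<nu> F k t"
  shows "grad_corr X y F l (m + 1) =
    grad_corr X y F l 1 - col_corr X l k * (1 - (1 - \<nu>) ^ m) * grad_corr X y F k 1"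
  using assms(2)
proof (induction m arbitrary: l)
  case 0
  then show ?case by simp
next
  case (Suc m)
  \<comment> \<open>Needed at two directions: \<open>k\<close>, which fixes the size of the next
    step, and \<open>l\<close>, whose correlation is tracked.\<close>
  then have IH: "grad_corr X y F i (m + 1) =
      grad_corr X y F i 1 - col_corr X i k * (1 - (1 - \<nu>) ^ m) * grad_corr X y F k 1" for i
    by simp
  have k: "grad_corr X y F k (m + 1) = (1 - \<nu>) ^ m * grad_corr X y F k 1"
    using IH[of k] by (simp add: col_corr_self[OF assms(1)] algebra_simps)
  have "step_along X y \<nu> F k (m + 1)"
    using Suc.prems by simp
  from grad_corr_step[OF this, of l] show ?case
    unfolding k IH[of l] by (simp add: algebra_simps)
qed

theorem theorem5:
  fixes X :: "real^'p^'n" and y :: "real^'n" and F :: "nat \<Rightarrow> real^'n"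
    and \<nu> :: real and m :: nat and j k :: 'p
  assumes "standardized X y"
    and "0 < \<nu>" and "\<nu> < 1"
    and "\<bar>grad_corr X y F k 1\<bar> = Max (range (\<lambda>i. \<bar>grad_corr X y F i 1\<bar>))"
    and "\<bar>grad_corr X y F k 1\<bar> \<noteq> 0"
    and "j \<noteq> k"
    and "m \<ge> 1"
    and "\<forall>t\<in>{1..m}. step_along X y \<nu> F k t"
    and "step_along X y \<nu> F j (m + 1)"
    and "1 - (1 - \<nu>) ^ m = nu_hat X y F j k"
    and "grad_ratio X y F m j k \<noteq> col_corr X j k"
  shows "more_favorable_next X y F (m + 1) k j"
proof -
  define r where "r = grad_corr X y F k 1"
  define a where "a = grad_corr X y F j 1"
  define R where "R = col_corr X j k"
  define q where "q = (1 - \<nu>) ^ m"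
  define s where "s = sgn (a / r - R)"
  have r: "r \<noteq> 0" and q: "q > 0"
    using assms(3,5) by (auto simp: r_def q_def)
  have q_eq: "q = \<bar>a / r - R\<bar> / (1 - R * s)"
    using assms(10) by (simp add: nu_hat_def grad_ratio_def Let_def q_def a_def r_def R_def s_def)
  \<comment> \<open>A zero numerator, or a zero denominator by the convention that division by zero
    gives 0, would make \<open>q\<close> vanish.\<close>
  have dR: "a / r - R \<noteq> 0" and Rs1: "R * s \<noteq> 1"
    using q q_eq by auto
  from dR have s: "s * s = 1" "\<bar>s\<bar> = 1"
    by (auto simp: s_def sgn_if)
  have R1: "\<bar>R\<bar> \<le> 1"
    using abs_col_corr_le_1[OF assms(1)] by (simp add: R_def)
  \<comment> \<open>Cauchy-Schwarz only gives the bound 1; strictness comes from the nonzero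
    denominator in \<open>Rs1\<close>.\<close>
  have "R * s \<le> \<bar>R\<bar> * \<bar>s\<bar>"
    by (metis abs_ge_self abs_mult)
  with R1 s Rs1 have Rs: "R * s < 1"
    by simp
  have "a / r - R = s * \<bar>a / r - R\<bar>"
    unfolding s_def by (simp add: sgn_mult_abs)
  also have "\<bar>a / r - R\<bar> = q * (1 - R * s)"
    using q_eq Rs1 by simp
  also have "s * (q * (1 - R * s)) = s * q - R * q * (s * s)"
    by (simp add: algebra_simps)
  finally have "a / r = R + s * q - R * q"
    using s by simp
  with r have a: "a = (R + s * q - R * q) * r"
    by (simp add: field_simps)
  have k1: "grad_corr X y F k (m + 1) = q * r"
    using grad_corr_steps[OF assms(1,8), of k]
    by (simp add: col_corr_self[OF assms(1)] q_def r_def algebra_simps)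
  have j1: "grad_corr X y F j (m + 1) = s * q * r"
    using grad_corr_steps[OF assms(1,8), of j] a
    unfolding a_def[symmetric] r_def[symmetric] R_def[symmetric] q_def[symmetric]
    by (simp add: algebra_simps)
  have j2: "grad_corr X y F j (m + 1 + 1) = (1 - \<nu>) * (s * q * r)"
    using grad_corr_step[OF assms(9), of j] j1
    by (simp add: col_corr_self[OF assms(1)] algebra_simps)
  have "col_corr X k j = R"
    by (simp add: R_def col_corr_def inner_commute)
  then have k2: "grad_corr X y F k (m + 1 + 1) = (1 - \<nu> * (R * s)) * (q * r)"
    using grad_corr_step[OF assms(9), of k] j1 k1 by (simp add: algebra_simps)
  have "\<nu> * (R * s) < \<nu>"
    using Rs assms(2) by simp
  then have "\<bar>1 - \<nu>\<bar> < \<bar>1 - \<nu> * (R * s)\<bar>"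
    using assms(3) by linarith
  then have "\<bar>1 - \<nu>\<bar> * \<bar>q * r\<bar> < \<bar>1 - \<nu> * (R * s)\<bar> * \<bar>q * r\<bar>"
    using q r by (intro mult_strict_right_mono) auto
  \<comment> \<open>The weak inequality at step \<open>m + 1\<close> holds as an equality, the tie
    given by \<open>\<bar>s\<bar> = 1\<close>; the strict one at the next step is the inequality
    just shown.\<close>
  then show ?thesis
    unfolding more_favorable_next_def j1 k1 j2 k2 using s by (simp add: abs_mult)
qed

end
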